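(* Let $I=[0,1]$, let $E$ be the Fréchet space of smooth functions $x:I\to\mathbb R$, and let $\varphi:\mathbb R\to\mathbb R$ be a smooth diffeomorphism. Let $f:E\to E$ be given by $f(x)=\varphi\circ x$. If $x\in E$ is such that $f$ is almost M-tame at $x$, then $\varphi''(t)=0$ for all $t$ in the range $\{x(s):s\in I\}$ of $x$.
   Context: Fréchet space: a complete metrizable real locally convex space. The space $E$ of smooth functions $I=[0,1]\to\mathbb R$ carries its usual topology, defined by the norms $p_i(u)=\sup\{|u^{(l)}(s)| : s\in I,\ 0\le l\le i\}$, $i=0,1,2,\dots$. P-norm: for a Fréchet space $E$, a P-norm for $E$ is any function $\varrho:E\to\mathbb R$ such that $(x,y)\mapsto\varrho(x-y)$ is a metric on $E$ defining the topology of $E$. Directional derivative: for Fréchet spaces $E,F$ and a function $f:E\supseteq\operatorname{dom} f\to F$, $\delta f(x,u)=\lim_{t\to0}t^{-1}(f(x+tu)-f(x))$ (limit in $F$) denotes the derivative of $f$ at $x\in\operatorname{dom} f$ in the direction $u\in E$. Almost M-tame: a directionally differentiable map $f:E\supseteq\operatorname{dom} f\to F$ between Fréchet spaces is called almost M-tame at $x$ iff there are P-norms $\varrho_1$ for $E$ and $\varrho_2$ for $F$ such that for all $z,u\in E$ with $\varrho_1(z)\le 1$ we have $x+z\in\operatorname{dom} f$ and $\varrho_2(\delta f(x+z,u)-\delta f(x,u))\le\varrho_1(u)$. Here $\operatorname{dom} f=E$ and $F=E$. *)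

theory Defs
  imports "HOL-Analysis.Analysis"
begin

section \<open>Frechet spaces, P-norms and almost M-tame maps\<close>

text \<open>\<open>topology open\<close> is \<open>euclidean\<close>. Convexity of \<open>V\<close> is written out, since neither
  constant is available for the type parameter of a class.
  The Cauchy condition is that of the translation invariant uniformity. Since the
  topology is metrizable, completeness may be expressed by sequences.\<close>

class frechet_space = real_vector + t2_space + topological_ab_group_add +
  assumes tendsto_scaleR_nhds:
      "((\<lambda>p. fst p *\<^sub>R snd p) \<longlongrightarrow> c *\<^sub>R x) (nhds c \<times>\<^sub>F nhds x)"
    and locally_convex:
      "open U \<Longrightarrow> x \<in> U \<Longrightarrow> \<exists>V. open V \<and> x \<in> V \<and> V \<subseteq> U \<and>
        (\<forall>y\<in>V. \<forall>z\<in>V. \<forall>u\<ge>0. \<forall>v\<ge>0. u + v = 1 \<longrightarrow> u *\<^sub>R y + v *\<^sub>R z \<in> V)"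
    and metrizable: "metrizable_space (topology open)"
    and sequentially_complete:
      "(\<And>U. open U \<Longrightarrow> 0 \<in> U \<Longrightarrow> \<exists>N. \<forall>m\<ge>N. \<forall>n\<ge>N. X m - X n \<in> U) \<Longrightarrow>
        \<exists>l. X \<longlonglongrightarrow> l"

definition P_norm :: "('a::frechet_space \<Rightarrow> real) \<Rightarrow> bool" where
  "P_norm \<rho> \<longleftrightarrow> Metric_space UNIV (\<lambda>x y. \<rho> (x - y)) \<and>
     Metric_space.mtopology UNIV (\<lambda>x y. \<rho> (x - y)) = euclidean"

definition dir_quotient ::
    "('a::frechet_space \<Rightarrow> 'b::frechet_space) \<Rightarrow> 'a \<Rightarrow> 'a \<Rightarrow> real \<Rightarrow> 'b" where
  "dir_quotient f x u t = (1 / t) *\<^sub>R (f (x + t *\<^sub>R u) - f x)"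

definition dir_deriv :: "('a::frechet_space \<Rightarrow> 'b::frechet_space) \<Rightarrow> 'a \<Rightarrow> 'a \<Rightarrow> 'b" where
  "dir_deriv f x u = Lim (at 0) (dir_quotient f x u)"

text \<open>A map \<open>E \<supseteq> dom f \<rightarrow> F\<close> is represented by a total function together with the set
  \<open>D = dom f\<close>. The first conjunct makes the limit depend on the values of \<open>f\<close> on \<open>D\<close> only.\<close>

definition dir_differentiable_on ::
    "('a::frechet_space) set \<Rightarrow> ('a \<Rightarrow> 'b::frechet_space) \<Rightarrow> bool" where
  "dir_differentiable_on D f \<longleftrightarrow> (\<forall>x\<in>D. \<forall>u.
     (\<forall>\<^sub>F t in at 0. x + t *\<^sub>R u \<in> D) \<and> (\<exists>l. (dir_quotient f x u \<longlongrightarrow> l) (at 0)))"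

definition almost_M_tame ::
    "('a::frechet_space) set \<Rightarrow> ('a \<Rightarrow> 'b::frechet_space) \<Rightarrow> 'a \<Rightarrow> bool" where
  "almost_M_tame D f x \<longleftrightarrow> dir_differentiable_on D f \<and>
     (\<exists>\<rho>\<^sub>1 \<rho>\<^sub>2. P_norm \<rho>\<^sub>1 \<and> P_norm \<rho>\<^sub>2 \<and>
       (\<forall>z u. \<rho>\<^sub>1 z \<le> 1 \<longrightarrow>
          x + z \<in> D \<and> \<rho>\<^sub>2 (dir_deriv f (x + z) u - dir_deriv f x u) \<le> \<rho>\<^sub>1 u))"

section \<open>Smooth functions of one real variable\<close>

definition deriv_within :: "real set \<Rightarrow> (real \<Rightarrow> real) \<Rightarrow> real \<Rightarrow> real" where
  "deriv_within S f s = vector_derivative f (at s within S)"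

definition smooth_on :: "real set \<Rightarrow> (real \<Rightarrow> real) \<Rightarrow> bool" where
  "smooth_on S f \<longleftrightarrow> (\<forall>k. (deriv_within S ^^ k) f differentiable_on S)"

definition smooth_diffeomorphism :: "(real \<Rightarrow> real) \<Rightarrow> bool" where
  "smooth_diffeomorphism \<phi> \<longleftrightarrow> bij \<phi> \<and> smooth_on UNIV \<phi> \<and> smooth_on UNIV (inv \<phi>)"

abbreviation unit_ivl :: "real set" where "unit_ivl \<equiv> {0..1}"

lemma smooth_on_unit_ivl_derivI:
  assumes "\<And>s. s \<in> unit_ivl \<Longrightarrow> F 0 s = f s"
    and F: "\<And>k s. s \<in> unit_ivl \<Longrightarrow> (F k has_vector_derivative F (Suc k) s) (at s within unit_ivl)"
  shows "smooth_on unit_ivl f"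
    and "\<And>k s. s \<in> unit_ivl \<Longrightarrow> (deriv_within unit_ivl ^^ k) f s = F k s"
proof -
  have D: "(g has_vector_derivative F (Suc k) s) (at s within unit_ivl)"
    if "\<And>s. s \<in> unit_ivl \<Longrightarrow> g s = F k s" "s \<in> unit_ivl" for g k s
    by (rule has_vector_derivative_transform[OF that(2) _ F[OF that(2)]]) (rule that(1))
  have *: "\<forall>s\<in>unit_ivl. (deriv_within unit_ivl ^^ k) f s = F k s" for k
  proof (induction k)
    case 0
    then show ?case using assms(1) by simp
  next
    case (Suc k)
    show ?case
    proof
      fix s assume s: "s \<in> unit_ivl"
      have "vector_derivative ((deriv_within unit_ivl ^^ k) f) (at s within unit_ivl) = F (Suc k) s"
        using s by (intro vector_derivative_within_closed_interval D) (use Suc s in auto)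
      then show "(deriv_within unit_ivl ^^ Suc k) f s = F (Suc k) s"
        by (simp add: deriv_within_def)
    qed
  qed
  then show "\<And>k s. s \<in> unit_ivl \<Longrightarrow> (deriv_within unit_ivl ^^ k) f s = F k s" by blast
  show "smooth_on unit_ivl f"
    unfolding smooth_on_def differentiable_on_def
    using * by (blast intro: differentiableI_vector D)
qed

lemma smooth_on_has_deriv_within:
  assumes "smooth_on unit_ivl f" "s \<in> unit_ivl"
  shows "((deriv_within unit_ivl ^^ k) f has_vector_derivative (deriv_within unit_ivl ^^ Suc k) f s)
           (at s within unit_ivl)"
  using assms
  by (simp add: deriv_within_def smooth_on_def differentiable_on_def vector_derivative_works)

section \<open>The space of smooth functions on the unit interval\<close>

text \<open>Functions on the unit interval are extended by \<open>0\<close>. Derivatives at \<open>0\<close> and \<open>1\<close> are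
  one-sided and do not see the extension.\<close>

typedef smooth_fun = "{x. smooth_on unit_ivl x \<and> (\<forall>s. s \<notin> unit_ivl \<longrightarrow> x s = 0)}"
  morphisms eval_smooth Abs_smooth_fun
proof
  show "(\<lambda>_. 0) \<in> {x. smooth_on unit_ivl x \<and> (\<forall>s. s \<notin> unit_ivl \<longrightarrow> x s = 0)}"
    using smooth_on_unit_ivl_derivI(1)[of "\<lambda>_ _. 0" "\<lambda>_. 0"] by simp
qed

setup_lifting type_definition_smooth_fun

definition smooth_deriv :: "nat \<Rightarrow> smooth_fun \<Rightarrow> real \<Rightarrow> real" where
  "smooth_deriv k x = (deriv_within unit_ivl ^^ k) (eval_smooth x)"

definition smooth_norm :: "nat \<Rightarrow> smooth_fun \<Rightarrow> real" where
  "smooth_norm i u = Sup {\<bar>smooth_deriv l u s\<bar> | s l. s \<in> unit_ivl \<and> l \<le> i}"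

lemma smooth_deriv_0: "smooth_deriv 0 x = eval_smooth x"
  by (simp add: smooth_deriv_def)

lemma smooth_deriv_has_deriv:
  "s \<in> unit_ivl \<Longrightarrow>
     (smooth_deriv k x has_vector_derivative smooth_deriv (Suc k) x s) (at s within unit_ivl)"
  unfolding smooth_deriv_def using eval_smooth by (intro smooth_on_has_deriv_within) auto

lemma smooth_fun_eqI: "(\<And>s. s \<in> unit_ivl \<Longrightarrow> eval_smooth x s = eval_smooth y s) \<Longrightarrow> x = y"
  using eval_smooth[of x] eval_smooth[of y]
  by (intro eval_smooth_inject[THEN iffD1]) (force simp: fun_eq_iff)

lemma smooth_deriv_eqI:
  assumes "\<And>s. s \<in> unit_ivl \<Longrightarrow> F 0 s = eval_smooth x s"
    and "\<And>k s. s \<in> unit_ivl \<Longrightarrow> (F k has_vector_derivative F (Suc k) s) (at s within unit_ivl)"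
    and "s \<in> unit_ivl"
  shows "smooth_deriv k x s = F k s"
  unfolding smooth_deriv_def by (rule smooth_on_unit_ivl_derivI(2)[OF assms])

lemma smooth_on_unit_ivl_add:
  assumes "smooth_on unit_ivl x" "smooth_on unit_ivl y"
  shows "smooth_on unit_ivl (\<lambda>s. x s + y s)"
  by (rule smooth_on_unit_ivl_derivI(1)[where
        F = "\<lambda>k s. (deriv_within unit_ivl ^^ k) x s + (deriv_within unit_ivl ^^ k) y s"],
      simp, rule has_vector_derivative_add) (blast intro: smooth_on_has_deriv_within assms)+

lemma smooth_on_unit_ivl_cmult:
  assumes "smooth_on unit_ivl x"
  shows "smooth_on unit_ivl (\<lambda>s. c * x s)"
  by (rule smooth_on_unit_ivl_derivI(1)[where F = "\<lambda>k s. c * (deriv_within unit_ivl ^^ k) x s"],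
      simp, rule has_vector_derivative_mult_right) (blast intro: smooth_on_has_deriv_within assms)

instantiation smooth_fun :: real_vector
begin

lift_definition zero_smooth_fun :: smooth_fun is "\<lambda>_. 0"
  using smooth_on_unit_ivl_derivI(1)[of "\<lambda>_ _. 0" "\<lambda>_. 0"] by simp

lift_definition plus_smooth_fun :: "smooth_fun \<Rightarrow> smooth_fun \<Rightarrow> smooth_fun"
  is "\<lambda>x y s. x s + y s"
  by (simp add: smooth_on_unit_ivl_add)

lift_definition scaleR_smooth_fun :: "real \<Rightarrow> smooth_fun \<Rightarrow> smooth_fun"
  is "\<lambda>c x s. c * x s"
  by (simp add: smooth_on_unit_ivl_cmult)

definition uminus_smooth_fun :: "smooth_fun \<Rightarrow> smooth_fun" where "- x = (- 1) *\<^sub>R x"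
  for x :: smooth_fun

definition minus_smooth_fun :: "smooth_fun \<Rightarrow> smooth_fun \<Rightarrow> smooth_fun" where "x - y = x + - y"
  for x y :: smooth_fun

instance
  by standard
    (auto intro!: smooth_fun_eqI simp: uminus_smooth_fun_def minus_smooth_fun_def
      zero_smooth_fun.rep_eq plus_smooth_fun.rep_eq scaleR_smooth_fun.rep_eq algebra_simps)

end

lemma smooth_deriv_add:
  "s \<in> unit_ivl \<Longrightarrow> smooth_deriv k (x + y) s = smooth_deriv k x s + smooth_deriv k y s"
  by (rule smooth_deriv_eqI[where F = "\<lambda>k s. smooth_deriv k x s + smooth_deriv k y s"])
    (auto intro!: has_vector_derivative_add smooth_deriv_has_deriv
      simp: smooth_deriv_0 plus_smooth_fun.rep_eq)

lemma smooth_deriv_scaleR: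
  "s \<in> unit_ivl \<Longrightarrow> smooth_deriv k (c *\<^sub>R x) s = c * smooth_deriv k x s"
  by (rule smooth_deriv_eqI[where F = "\<lambda>k s. c * smooth_deriv k x s"])
    (auto intro!: has_vector_derivative_mult_right smooth_deriv_has_deriv
      simp: smooth_deriv_0 scaleR_smooth_fun.rep_eq)

lemma smooth_deriv_diff:
  "s \<in> unit_ivl \<Longrightarrow> smooth_deriv k (x - y) s = smooth_deriv k x s - smooth_deriv k y s"
  using smooth_deriv_add[of s k x "(- 1) *\<^sub>R y"] smooth_deriv_scaleR[of s k "- 1" y] by simp

lemma bdd_above_smooth_norm: "bdd_above {\<bar>smooth_deriv l u s\<bar> | s l. s \<in> unit_ivl \<and> l \<le> i}"
proof -
  have "bdd_above ((\<lambda>s. \<bar>smooth_deriv l u s\<bar>) ` unit_ivl)" for l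
  proof -
    have "continuous_on unit_ivl (smooth_deriv l u)"
      using smooth_deriv_has_deriv has_vector_derivative_continuous
      unfolding continuous_on_eq_continuous_within by blast
    then show ?thesis
      by (intro compact_imp_bounded[THEN bounded_imp_bdd_above] compact_continuous_image
          continuous_intros) auto
  qed
  moreover have "{\<bar>smooth_deriv l u s\<bar> | s l. s \<in> unit_ivl \<and> l \<le> i} =
      (\<Union>l\<in>{..i}. (\<lambda>s. \<bar>smooth_deriv l u s\<bar>) ` unit_ivl)"
    by blast
  ultimately show ?thesis by simp
qed

lemma smooth_norm_upper:
  "s \<in> unit_ivl \<Longrightarrow> l \<le> i \<Longrightarrow> \<bar>smooth_deriv l u s\<bar> \<le> smooth_norm i u"
  unfolding smooth_norm_def by (rule cSup_upper[OF _ bdd_above_smooth_norm]) auto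

lemma smooth_norm_least:
  "(\<And>s l. s \<in> unit_ivl \<Longrightarrow> l \<le> i \<Longrightarrow> \<bar>smooth_deriv l u s\<bar> \<le> b) \<Longrightarrow> smooth_norm i u \<le> b"
proof -
  assume *: "\<And>s l. s \<in> unit_ivl \<Longrightarrow> l \<le> i \<Longrightarrow> \<bar>smooth_deriv l u s\<bar> \<le> b"
  have "\<bar>smooth_deriv 0 u 0\<bar> \<in> {\<bar>smooth_deriv l u s\<bar> | s l. s \<in> unit_ivl \<and> l \<le> i}"
    by fastforce
  then show ?thesis
    unfolding smooth_norm_def using * by (intro cSup_least) auto
qed

lemma smooth_norm_nonneg: "0 \<le> smooth_norm i u"
  using smooth_norm_upper[of 0 0 i u] by fastforce

lemma smooth_norm_mono: "i \<le> j \<Longrightarrow> smooth_norm i u \<le> smooth_norm j u"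
  by (rule smooth_norm_least) (simp add: smooth_norm_upper)

lemma smooth_norm_triangle: "smooth_norm i (x + y) \<le> smooth_norm i x + smooth_norm i y"
proof (rule smooth_norm_least)
  fix s l assume "s \<in> unit_ivl" "l \<le> i"
  then show "\<bar>smooth_deriv l (x + y) s\<bar> \<le> smooth_norm i x + smooth_norm i y"
    using smooth_norm_upper[of s l i x] smooth_norm_upper[of s l i y]
    by (simp add: smooth_deriv_add)
qed

lemma smooth_norm_scaleR_le: "smooth_norm i (c *\<^sub>R x) \<le> \<bar>c\<bar> * smooth_norm i x"
  by (rule smooth_norm_least)
    (simp add: smooth_deriv_scaleR abs_mult mult_left_mono smooth_norm_upper)

lemma smooth_norm_minus_commute: "smooth_norm i (x - y) = smooth_norm i (y - x)"
  using smooth_norm_scaleR_le[of i "- 1" "x - y"] smooth_norm_scaleR_le[of i "- 1" "y - x"] by simp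

lemma smooth_norm_0 [simp]: "smooth_norm i 0 = 0"
  using smooth_norm_scaleR_le[of i 0 0] smooth_norm_nonneg[of i 0] by simp

lemma smooth_norm_diff_triangle:
  "smooth_norm i (x - z) \<le> smooth_norm i (x - y) + smooth_norm i (y - z)"
  using smooth_norm_triangle[of i "x - y" "y - z"] by simp

lemma smooth_norm_eq_0D: "smooth_norm 0 (x - y) = 0 \<Longrightarrow> x = y"
  using smooth_norm_upper[of _ 0 0 "x - y"] smooth_deriv_diff[of _ 0 x y]
  by (intro smooth_fun_eqI) (simp add: smooth_deriv_0)

instantiation smooth_fun :: topological_space
begin

text \<open>As the norms increase with \<open>i\<close>, the balls of single norms form a base.\<close>

definition open_smooth_fun :: "smooth_fun set \<Rightarrow> bool" where
  "open_smooth_fun U \<longleftrightarrow>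
     (\<forall>x\<in>U. \<exists>i. \<exists>e>0. \<forall>y. smooth_norm i (y - x) < e \<longrightarrow> y \<in> U)"

instance
proof
  show "open (UNIV :: smooth_fun set)"
    unfolding open_smooth_fun_def using zero_less_one by blast
next
  fix S T :: "smooth_fun set" assume ST: "open S" "open T"
  show "open (S \<inter> T)"
    unfolding open_smooth_fun_def
  proof
    fix x assume "x \<in> S \<inter> T"
    then obtain i e j d where *: "e > 0" "\<And>y. smooth_norm i (y - x) < e \<Longrightarrow> y \<in> S"
      "d > 0" "\<And>y. smooth_norm j (y - x) < d \<Longrightarrow> y \<in> T"
      using ST unfolding open_smooth_fun_def by (metis IntE)
    have "y \<in> S \<inter> T" if "smooth_norm (max i j) (y - x) < min e d" for y
      using * that smooth_norm_mono[of i "max i j" "y - x"] smooth_norm_mono[of j "max i j" "y - x"]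
      by force
    then show "\<exists>i. \<exists>e>0. \<forall>y. smooth_norm i (y - x) < e \<longrightarrow> y \<in> S \<inter> T"
      using *(1,3) by (metis min_less_iff_conj)
  qed
next
  fix K :: "smooth_fun set set" assume "\<forall>S\<in>K. open S"
  then show "open (\<Union>K)" unfolding open_smooth_fun_def by (meson UnionE UnionI)
qed

end

lemma open_smooth_ball: "open {y. smooth_norm i (y - x) < e}"
  unfolding open_smooth_fun_def
proof
  fix y assume y: "y \<in> {y. smooth_norm i (y - x) < e}"
  have "z \<in> {y. smooth_norm i (y - x) < e}"
    if "smooth_norm i (z - y) < e - smooth_norm i (y - x)" for z
    using that smooth_norm_diff_triangle[of i z x y] by simp
  then show "\<exists>j. \<exists>d>0. \<forall>z. smooth_norm j (z - y) < d \<longrightarrow> z \<in> {y. smooth_norm i (y - x) < e}"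
    using y by (intro exI[of _ i] exI[of _ "e - smooth_norm i (y - x)"]) auto
qed

lemma tendsto_smooth_fun_iff:
  "(f \<longlongrightarrow> a) F \<longleftrightarrow> (\<forall>i. ((\<lambda>z. smooth_norm i (f z - a)) \<longlongrightarrow> 0) F)"
proof
  assume f: "(f \<longlongrightarrow> a) F"
  show "\<forall>i. ((\<lambda>z. smooth_norm i (f z - a)) \<longlongrightarrow> 0) F"
  proof
    fix i
    have "\<forall>\<^sub>F z in F. smooth_norm i (f z - a) < e" if "e > 0" for e
      using topological_tendstoD[OF f open_smooth_ball[of i a e]] that by simp
    then show "((\<lambda>z. smooth_norm i (f z - a)) \<longlongrightarrow> 0) F"
      by (intro tendstoI) (simp add: smooth_norm_nonneg)
  qed
next
  assume *: "\<forall>i. ((\<lambda>z. smooth_norm i (f z - a)) \<longlongrightarrow> 0) F"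
  show "(f \<longlongrightarrow> a) F"
  proof (rule topological_tendstoI)
    fix S assume "open S" "a \<in> S"
    then obtain i e where e: "e > 0" "\<And>y. smooth_norm i (y - a) < e \<Longrightarrow> y \<in> S"
      unfolding open_smooth_fun_def by blast
    have "\<forall>\<^sub>F z in F. smooth_norm i (f z - a) < e"
      using * e(1) order_tendstoD(2) by blast
    then show "\<forall>\<^sub>F z in F. f z \<in> S" by (rule eventually_mono) (rule e(2))
  qed
qed

text \<open>A translation invariant metric that defines the topology.\<close>

definition smooth_pnorm :: "smooth_fun \<Rightarrow> real" where
  "smooth_pnorm u = (SUP i. min (smooth_norm i u) (1 / real (Suc i)))"

lemma smooth_pnorm_upper: "min (smooth_norm i u) (1 / real (Suc i)) \<le> smooth_pnorm u"
  unfolding smooth_pnorm_def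
  by (rule cSUP_upper) (auto intro!: bdd_aboveI2[where M = 1] simp: min_le_iff_disj)

lemma smooth_pnorm_least:
  "(\<And>i. min (smooth_norm i u) (1 / real (Suc i)) \<le> b) \<Longrightarrow> smooth_pnorm u \<le> b"
  unfolding smooth_pnorm_def by (rule cSUP_least) auto

lemma smooth_pnorm_triangle: "smooth_pnorm (x + y) \<le> smooth_pnorm x + smooth_pnorm y"
proof (rule smooth_pnorm_least)
  fix i
  have min_add: "min c d \<le> min a d + min b d"
    if "c \<le> a + b" "0 \<le> a" "0 \<le> b" "0 \<le> d" for a b c d :: real
    using that by (auto simp: min_def)
  have "min (smooth_norm i (x + y)) (1 / real (Suc i)) \<le>
      min (smooth_norm i x) (1 / real (Suc i)) + min (smooth_norm i y) (1 / real (Suc i))"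
    by (intro min_add smooth_norm_triangle smooth_norm_nonneg) simp
  then show "min (smooth_norm i (x + y)) (1 / real (Suc i)) \<le> smooth_pnorm x + smooth_pnorm y"
    using smooth_pnorm_upper[of i x] smooth_pnorm_upper[of i y] by linarith
qed

lemma smooth_pnorm_nonneg: "0 \<le> smooth_pnorm u"
  using smooth_pnorm_upper[of 0 u] smooth_norm_nonneg[of 0 u] by (simp add: min_def split: if_splits)

lemma Metric_space_smooth_pnorm: "Metric_space UNIV (\<lambda>x y. smooth_pnorm (x - y))"
proof
  fix x y z :: smooth_fun
  show "0 \<le> smooth_pnorm (x - y)" by (rule smooth_pnorm_nonneg)
  show "smooth_pnorm (x - y) = smooth_pnorm (y - x)"
    unfolding smooth_pnorm_def by (simp add: smooth_norm_minus_commute)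
  show "smooth_pnorm (x - z) \<le> smooth_pnorm (x - y) + smooth_pnorm (y - z)"
    using smooth_pnorm_triangle[of "x - y" "y - z"] by simp
  show "smooth_pnorm (x - y) = 0 \<longleftrightarrow> x = y"
  proof
    assume "smooth_pnorm (x - y) = 0"
    then have "smooth_norm 0 (x - y) = 0"
      using smooth_pnorm_upper[of 0 "x - y"] smooth_norm_nonneg[of 0 "x - y"]
      by (simp add: min_def split: if_splits)
    then show "x = y" by (rule smooth_norm_eq_0D)
  qed (simp add: smooth_pnorm_def)
qed

lemma smooth_pnorm_mtopology:
  "Metric_space.mtopology UNIV (\<lambda>x y. smooth_pnorm (x - y)) = euclidean"
proof -
  interpret Metric_space UNIV "\<lambda>x y. smooth_pnorm (x - y)" by (rule Metric_space_smooth_pnorm)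
  have "openin mtopology U \<longleftrightarrow> open U" for U
  proof
    assume U: "openin mtopology U"
    show "open U"
      unfolding open_smooth_fun_def
    proof
      fix x assume "x \<in> U"
      then obtain r where r: "r > 0" "mball x r \<subseteq> U" using U openin_mtopology by auto
      obtain i where i: "1 / real (Suc i) < r / 2"
        using r(1) nat_approx_posE[of "r / 2"] by auto
      have "y \<in> U" if y: "smooth_norm i (y - x) < r / 2" for y
      proof -
        have "smooth_pnorm (x - y) \<le> r / 2"
        proof (rule smooth_pnorm_least)
          fix j
          show "min (smooth_norm j (x - y)) (1 / real (Suc j)) \<le> r / 2"
          proof (cases "j \<le> i")
            case True
            then show ?thesis
              using smooth_norm_mono[OF True, of "x - y"] y smooth_norm_minus_commute[of i x y]
              by simp
          next
            case False
            then have "1 / real (Suc j) \<le> 1 / real (Suc i)" by (intro divide_left_mono) auto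
            then show ?thesis using i by linarith
          qed
        qed
        then show ?thesis using r by (auto simp: mball_def)
      qed
      then show "\<exists>i. \<exists>e>0. \<forall>y. smooth_norm i (y - x) < e \<longrightarrow> y \<in> U"
        using r(1) half_gt_zero by blast
    qed
  next
    assume U: "open U"
    have "\<exists>r>0. mball x r \<subseteq> U" if "x \<in> U" for x
    proof -
      have "\<exists>i. \<exists>e>0. \<forall>y. smooth_norm i (y - x) < e \<longrightarrow> y \<in> U"
        using U[unfolded open_smooth_fun_def] that by (rule bspec)
      then obtain i e where e: "e > 0" "\<And>y. smooth_norm i (y - x) < e \<Longrightarrow> y \<in> U"
        by metis
      have "y \<in> U" if y: "smooth_pnorm (x - y) < min e (1 / real (Suc i))" for y
      proof (rule e(2))
        have "min (smooth_norm i (x - y)) (1 / real (Suc i)) < min e (1 / real (Suc i))"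
          using smooth_pnorm_upper y by (rule le_less_trans)
        then have "smooth_norm i (x - y) < e" by (auto simp only: min_less_iff_disj)
        then show "smooth_norm i (y - x) < e" by (simp add: smooth_norm_minus_commute[of i y x])
      qed
      then have "mball x (min e (1 / real (Suc i))) \<subseteq> U" unfolding mball_def by blast
      moreover have "min e (1 / real (Suc i)) > 0" using e(1) by simp
      ultimately show ?thesis by blast
    qed
    then show "openin mtopology U" using openin_mtopology by auto
  qed
  then show ?thesis by (simp add: topology_eq)
qed

lemma smooth_fun_Cauchy_convergent:
  fixes X :: "nat \<Rightarrow> smooth_fun"
  assumes "\<And>U. open U \<Longrightarrow> 0 \<in> U \<Longrightarrow> \<exists>N. \<forall>m\<ge>N. \<forall>n\<ge>N. X m - X n \<in> U"
  shows "\<exists>l. X \<longlonglongrightarrow> l"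
proof -
  have C: "\<exists>N. \<forall>m\<ge>N. \<forall>n\<ge>N. smooth_norm i (X m - X n) < e" if "e > 0" for i e
    using assms[OF open_smooth_ball[of i 0 e]] that by simp
  have "uniformly_Cauchy_on unit_ivl (\<lambda>n. smooth_deriv k (X n))" for k
    unfolding uniformly_Cauchy_on_def
  proof (intro allI impI)
    fix e :: real assume "e > 0"
    then obtain N where N: "\<And>m n. m \<ge> N \<Longrightarrow> n \<ge> N \<Longrightarrow> smooth_norm k (X m - X n) < e"
      using C by blast
    have "dist (smooth_deriv k (X m) s) (smooth_deriv k (X n) s) < e"
      if "s \<in> unit_ivl" "m \<ge> N" "n \<ge> N" for s m n
      using smooth_norm_upper[OF that(1) order_refl, of k "X m - X n"] N[OF that(2,3)]
      by (simp only: dist_real_def smooth_deriv_diff[OF that(1)])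
    then show "\<exists>N. \<forall>s\<in>unit_ivl. \<forall>m\<ge>N. \<forall>n\<ge>N.
        dist (smooth_deriv k (X m) s) (smooth_deriv k (X n) s) < e" by blast
  qed
  then have "\<exists>g. uniform_limit unit_ivl (\<lambda>n. smooth_deriv k (X n)) g sequentially" for k
    using Cauchy_uniformly_convergent unfolding uniformly_convergent_on_def by blast
  then obtain G where G: "\<And>k. uniform_limit unit_ivl (\<lambda>n. smooth_deriv k (X n)) (G k) sequentially"
    by metis
  have lim: "(\<lambda>n. smooth_deriv k (X n) s) \<longlonglongrightarrow> G k s" if "s \<in> unit_ivl" for k s
    using tendsto_uniform_limitI[OF G that] .
  have DG: "(G k has_vector_derivative G (Suc k) s) (at s within unit_ivl)" if s: "s \<in> unit_ivl" for k s
  proof -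
    have "\<exists>g. \<forall>x\<in>unit_ivl. (\<lambda>n. smooth_deriv k (X n) x) \<longlonglongrightarrow> g x \<and>
        (g has_derivative (\<lambda>h. h * G (Suc k) x)) (at x within unit_ivl)"
    proof (rule has_derivative_sequence[where f' = "\<lambda>n x h. h * smooth_deriv (Suc k) (X n) x"])
      show "((smooth_deriv k (X n)) has_derivative (\<lambda>h. h * smooth_deriv (Suc k) (X n) x))
          (at x within unit_ivl)" if "x \<in> unit_ivl" for n x
        using smooth_deriv_has_deriv[OF that, of k "X n"] by (simp add: has_vector_derivative_def)
      show "\<forall>\<^sub>F n in sequentially. \<forall>x\<in>unit_ivl. \<forall>h.
          norm (h * smooth_deriv (Suc k) (X n) x - h * G (Suc k) x) \<le> e * norm h"
        if "e > 0" for e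
        using uniform_limitD[OF G[of "Suc k"] that]
      proof eventually_elim
        case (elim n)
        show ?case
        proof (intro ballI allI)
          fix x h assume "x \<in> unit_ivl"
          then have "\<bar>smooth_deriv (Suc k) (X n) x - G (Suc k) x\<bar> \<le> e"
            using elim by (force simp: dist_real_def)
          then have "\<bar>h\<bar> * \<bar>smooth_deriv (Suc k) (X n) x - G (Suc k) x\<bar> \<le> \<bar>h\<bar> * e"
            by (intro mult_left_mono) auto
          then show "norm (h * smooth_deriv (Suc k) (X n) x - h * G (Suc k) x) \<le> e * norm h"
            by (simp add: abs_mult[symmetric] algebra_simps)
        qed
      qed
    qed (use s lim[OF s, of k] in auto)
    then obtain g where g: "\<And>x. x \<in> unit_ivl \<Longrightarrow> (\<lambda>n. smooth_deriv k (X n) x) \<longlonglongrightarrow> g x"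
      "\<And>x. x \<in> unit_ivl \<Longrightarrow> (g has_vector_derivative G (Suc k) x) (at x within unit_ivl)"
      unfolding has_vector_derivative_def real_scaleR_def by blast
    have "G k x = g x" if "x \<in> unit_ivl" for x
      using LIMSEQ_unique[OF lim[OF that] g(1)[OF that]] .
    then show ?thesis
      by (rule has_vector_derivative_transform[OF s _ g(2)[OF s]])
  qed
  define l where "l = Abs_smooth_fun (\<lambda>s. if s \<in> unit_ivl then G 0 s else 0)"
  have l: "eval_smooth l = (\<lambda>s. if s \<in> unit_ivl then G 0 s else 0)"
    unfolding l_def
    using smooth_on_unit_ivl_derivI(1)[of G "\<lambda>s. if s \<in> unit_ivl then G 0 s else 0"] DG
    by (intro Abs_smooth_fun_inverse) auto
  have dl: "smooth_deriv k l s = G k s" if "s \<in> unit_ivl" for k s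
    by (rule smooth_deriv_eqI[where F = G]) (use that in \<open>simp_all add: l DG\<close>)
  have "(\<lambda>n. smooth_norm i (X n - l)) \<longlonglongrightarrow> 0" for i
  proof (rule LIMSEQ_I)
    fix e :: real assume e: "e > 0"
    obtain N where N: "\<And>m n. m \<ge> N \<Longrightarrow> n \<ge> N \<Longrightarrow> smooth_norm i (X m - X n) < e / 2"
      using C[of "e / 2"] e by (meson half_gt_zero)
    have "smooth_norm i (X m - l) \<le> e / 2" if "m \<ge> N" for m
    proof (rule smooth_norm_least)
      fix s j assume s: "s \<in> unit_ivl" and j: "j \<le> i"
      have "(\<lambda>n. \<bar>smooth_deriv j (X m) s - smooth_deriv j (X n) s\<bar>)
          \<longlonglongrightarrow> \<bar>smooth_deriv j (X m) s - G j s\<bar>"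
        by (intro tendsto_intros lim s)
      moreover have "\<bar>smooth_deriv j (X m) s - smooth_deriv j (X n) s\<bar> \<le> e / 2" if "n \<ge> N" for n
        using smooth_norm_upper[OF s j, of "X m - X n"] N[OF \<open>m \<ge> N\<close> that]
        by (simp add: smooth_deriv_diff[OF s])
      ultimately have "\<bar>smooth_deriv j (X m) s - G j s\<bar> \<le> e / 2"
        by (intro LIMSEQ_le_const2) auto
      then show "\<bar>smooth_deriv j (X m - l) s\<bar> \<le> e / 2"
        by (simp add: smooth_deriv_diff[OF s] dl[OF s])
    qed
    then show "\<exists>N. \<forall>n\<ge>N. norm (smooth_norm i (X n - l) - 0) < e"
      using e smooth_norm_nonneg by (intro exI[of _ N]) fastforce
  qed
  then show ?thesis using tendsto_smooth_fun_iff by blast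
qed

instance smooth_fun :: frechet_space
proof
  fix x y :: smooth_fun assume xy: "x \<noteq> y"
  define e where "e = smooth_norm 0 (x - y) / 2"
  have e: "e > 0"
    using xy smooth_norm_eq_0D smooth_norm_nonneg[of 0 "x - y"] unfolding e_def
    by (metis half_gt_zero order_le_less)
  have "{z. smooth_norm 0 (z - x) < e} \<inter> {z. smooth_norm 0 (z - y) < e} = {}"
  proof -
    have False if "smooth_norm 0 (z - x) < e" "smooth_norm 0 (z - y) < e" for z
      using that smooth_norm_diff_triangle[of 0 x y z] smooth_norm_minus_commute[of 0 x z]
      unfolding e_def by linarith
    then show ?thesis by blast
  qed
  then show "\<exists>U V. open U \<and> open V \<and> x \<in> U \<and> y \<in> V \<and> U \<inter> V = {}"
    using e open_smooth_ball
    by (intro exI[of _ "{z. smooth_norm 0 (z - x) < e}"] exI[of _ "{z. smooth_norm 0 (z - y) < e}"])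
      auto
next
  fix a b :: smooth_fun
  show "((\<lambda>p. fst p + snd p) \<longlongrightarrow> a + b) (nhds a \<times>\<^sub>F nhds b)"
    unfolding tendsto_smooth_fun_iff
  proof
    fix i
    have a: "((\<lambda>p. smooth_norm i (fst p - a)) \<longlongrightarrow> 0) (nhds a \<times>\<^sub>F nhds b)"
      using filterlim_fst[of "nhds a" "nhds b"] tendsto_smooth_fun_iff[of fst a] by blast
    have b: "((\<lambda>p. smooth_norm i (snd p - b)) \<longlongrightarrow> 0) (nhds a \<times>\<^sub>F nhds b)"
      using filterlim_snd[of "nhds b" "nhds a"] tendsto_smooth_fun_iff[of snd b] by blast
    have "smooth_norm i (fst p + snd p - (a + b)) \<le>
        smooth_norm i (fst p - a) + smooth_norm i (snd p - b)" for p
      using smooth_norm_triangle[of i "fst p - a" "snd p - b"] by (simp add: algebra_simps)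
    then show "((\<lambda>p. smooth_norm i (fst p + snd p - (a + b))) \<longlongrightarrow> 0) (nhds a \<times>\<^sub>F nhds b)"
      by (intro tendsto_sandwich[OF _ _ tendsto_const tendsto_add_zero[OF a b]])
        (auto simp: smooth_norm_nonneg)
  qed
next
  fix a :: smooth_fun
  have *: "((\<lambda>x. x) \<longlongrightarrow> a) (nhds a)" by (rule filterlim_ident)
  show "(uminus \<longlongrightarrow> - a) (nhds a)"
    using * unfolding tendsto_smooth_fun_iff by (simp add: smooth_norm_minus_commute)
next
  fix c :: real and x :: smooth_fun
  show "((\<lambda>p. fst p *\<^sub>R snd p) \<longlongrightarrow> c *\<^sub>R x) (nhds c \<times>\<^sub>F nhds x)"
    unfolding tendsto_smooth_fun_iff
  proof
    fix i
    let ?F = "nhds c \<times>\<^sub>F nhds x"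
    have c: "(fst \<longlongrightarrow> c) ?F" by (rule filterlim_fst)
    have x: "((\<lambda>p. smooth_norm i (snd p - x)) \<longlongrightarrow> 0) ?F"
      using filterlim_snd[of "nhds x" "nhds c"] tendsto_smooth_fun_iff[of snd x] by blast
    have "((\<lambda>p. \<bar>fst p\<bar> * smooth_norm i (snd p - x) + \<bar>fst p - c\<bar> * smooth_norm i x)
        \<longlongrightarrow> \<bar>c\<bar> * 0 + \<bar>c - c\<bar> * smooth_norm i x) ?F"
      by (intro tendsto_intros c x)
    then have lim: "((\<lambda>p. \<bar>fst p\<bar> * smooth_norm i (snd p - x) + \<bar>fst p - c\<bar> * smooth_norm i x)
        \<longlongrightarrow> 0) ?F" by simp
    have "smooth_norm i (fst p *\<^sub>R snd p - c *\<^sub>R x) \<le>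
        \<bar>fst p\<bar> * smooth_norm i (snd p - x) + \<bar>fst p - c\<bar> * smooth_norm i x" for p
      using smooth_norm_triangle[of i "fst p *\<^sub>R (snd p - x)" "(fst p - c) *\<^sub>R x"]
        smooth_norm_scaleR_le[of i "fst p" "snd p - x"] smooth_norm_scaleR_le[of i "fst p - c" x]
      by (simp add: algebra_simps)
    then show "((\<lambda>p. smooth_norm i (fst p *\<^sub>R snd p - c *\<^sub>R x)) \<longlongrightarrow> 0) ?F"
      by (intro tendsto_sandwich[OF _ _ tendsto_const lim]) (auto simp: smooth_norm_nonneg)
  qed
next
  fix U and x :: smooth_fun assume "open U" "x \<in> U"
  then obtain i e where e: "e > 0" "\<And>y. smooth_norm i (y - x) < e \<Longrightarrow> y \<in> U"
    unfolding open_smooth_fun_def by blast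
  have "convex {y. smooth_norm i (y - x) < e}"
  proof (rule convexI)
    fix y z and u v :: real
    assume yz: "y \<in> {y. smooth_norm i (y - x) < e}" "z \<in> {y. smooth_norm i (y - x) < e}"
      and uv: "0 \<le> u" "0 \<le> v" "u + v = 1"
    have "u *\<^sub>R y + v *\<^sub>R z - x = u *\<^sub>R y + v *\<^sub>R z - (u + v) *\<^sub>R x" using uv by simp
    also have "\<dots> = u *\<^sub>R (y - x) + v *\<^sub>R (z - x)" by (simp add: algebra_simps)
    finally have "smooth_norm i (u *\<^sub>R y + v *\<^sub>R z - x) \<le>
        u * smooth_norm i (y - x) + v * smooth_norm i (z - x)"
      using smooth_norm_triangle[of i "u *\<^sub>R (y - x)" "v *\<^sub>R (z - x)"]
        smooth_norm_scaleR_le[of i u "y - x"] smooth_norm_scaleR_le[of i v "z - x"] uv by simp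
    also have "\<dots> < e" using yz uv by (intro convex_bound_lt) auto
    finally show "u *\<^sub>R y + v *\<^sub>R z \<in> {y. smooth_norm i (y - x) < e}" by simp
  qed
  then show "\<exists>V. open V \<and> x \<in> V \<and> V \<subseteq> U \<and>
      (\<forall>y\<in>V. \<forall>z\<in>V. \<forall>u\<ge>0. \<forall>v\<ge>0. u + v = 1 \<longrightarrow> u *\<^sub>R y + v *\<^sub>R z \<in> V)"
    unfolding convex_def[symmetric]
    using e open_smooth_ball by (intro exI[of _ "{y. smooth_norm i (y - x) < e}"]) auto
next
  show "metrizable_space (topology (open :: smooth_fun set \<Rightarrow> bool))"
    unfolding metrizable_space_def
    using Metric_space_smooth_pnorm smooth_pnorm_mtopology by metis
next
  fix X :: "nat \<Rightarrow> smooth_fun"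
  assume "\<And>U. open U \<Longrightarrow> 0 \<in> U \<Longrightarrow> \<exists>N. \<forall>m\<ge>N. \<forall>n\<ge>N. X m - X n \<in> U"
  then show "\<exists>l. X \<longlonglongrightarrow> l" by (rule smooth_fun_Cauchy_convergent)
qed

end

theory Submission
  imports Defs
begin

text \<open>The directional derivative of \<open>f\<close> is \<open>\<delta>f(y,u) = (\<phi>' \<circ> y) \<cdot> u\<close>. Tameness, applied to a
  single small constant direction \<open>u\<close>, forces the functions \<open>\<phi>' \<circ> (x + z)\<close> to be bounded in every
  \<open>C\<^sup>k\<close> norm when \<open>z\<close> ranges over a ball of one fixed norm \<open>p\<^sub>i\<close>. The top order term of the
  \<open>k\<close>-th derivative of \<open>\<phi>' \<circ> y\<close> is \<open>(\<phi>'' \<circ> y) \<cdot> y\<^sup>(\<^sup>k\<^sup>)\<close>, and the remainder is controlled by the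
  derivatives of \<open>y\<close> of order below \<open>k\<close>. Take \<open>k = 2i + 1\<close> and
  \<open>z(s) = d n\<^sup>-\<^sup>2\<^sup>i sin (n (s - s\<^sub>0))\<close>: the derivatives of \<open>z\<close> up to order \<open>2i\<close> are at most \<open>d\<close>,
  \<open>z(s\<^sub>0) = 0\<close>, but \<open>\<bar>z\<^sup>(\<^sup>k\<^sup>)(s\<^sub>0)\<bar> = d n\<close> is unbounded, hence \<open>\<phi>''(x(s\<^sub>0)) = 0\<close>.\<close>

section \<open>Sequences of successive derivatives\<close>

text \<open>Carrying the whole sequence turns differentiation into an index shift, on
  \<open>unit_ivl\<close> (one-sided at the ends) and on the line alike.\<close>

definition deriv_seq :: "real set \<Rightarrow> (nat \<Rightarrow> real \<Rightarrow> real) \<Rightarrow> bool" where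
  "deriv_seq S F \<longleftrightarrow> (\<forall>k. \<forall>s\<in>S. (F k has_real_derivative F (Suc k) s) (at s within S))"

lemma deriv_seqD:
  "deriv_seq S F \<Longrightarrow> s \<in> S \<Longrightarrow> (F k has_real_derivative F (Suc k) s) (at s within S)"
  by (simp add: deriv_seq_def)

lemma deriv_seq_Suc: "deriv_seq S F \<Longrightarrow> deriv_seq S (\<lambda>k. F (Suc k))"
  by (simp add: deriv_seq_def)

section \<open>Iterated product and chain rules\<close>

text \<open>The k-th derivative of a product as \<open>2 ^ k\<close> uncollected terms: without
  binomial coefficients, induction over \<open>k\<close> with shifted sequences suffices.\<close>

primrec leibniz :: "nat \<Rightarrow> (nat \<Rightarrow> real \<Rightarrow> real) \<Rightarrow> (nat \<Rightarrow> real \<Rightarrow> real) \<Rightarrow> real \<Rightarrow> real" where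
  "leibniz 0 U V = (\<lambda>s. U 0 s * V 0 s)"
| "leibniz (Suc k) U V = (\<lambda>s. leibniz k (\<lambda>j. U (Suc j)) V s + leibniz k U (\<lambda>j. V (Suc j)) s)"

lemma deriv_seq_leibniz:
  assumes "deriv_seq S U" "deriv_seq S V"
  shows "deriv_seq S (\<lambda>k. leibniz k U V)"
proof -
  have "(leibniz k U V has_real_derivative leibniz (Suc k) U V s) (at s within S)"
    if "s \<in> S" for k s
    using assms
  proof (induction k arbitrary: U V)
    case 0
    then show ?case
      using that by (auto intro!: derivative_eq_intros deriv_seqD)
  next
    case (Suc k)
    show ?case
      using DERIV_add[OF Suc.IH[OF deriv_seq_Suc[OF Suc.prems(1)] Suc.prems(2)]
          Suc.IH[OF Suc.prems(1) deriv_seq_Suc[OF Suc.prems(2)]]] by simp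
  qed
  then show ?thesis by (simp add: deriv_seq_def)
qed

lemma leibniz_bound:
  assumes "\<And>j. j \<le> k \<Longrightarrow> \<bar>U j s\<bar> \<le> a" "\<And>j. j \<le> k \<Longrightarrow> \<bar>V j s\<bar> \<le> b"
  shows "\<bar>leibniz k U V s\<bar> \<le> 2 ^ k * a * b"
  using assms
proof (induction k arbitrary: U V)
  case 0
  then show ?case by (simp add: abs_mult mult_mono' order_trans[OF abs_ge_zero])
next
  case (Suc k)
  have "\<bar>leibniz k (\<lambda>j. U (Suc j)) V s\<bar> \<le> 2 ^ k * a * b"
    "\<bar>leibniz k U (\<lambda>j. V (Suc j)) s\<bar> \<le> 2 ^ k * a * b"
    by (rule Suc.IH; simp add: Suc.prems)+
  then show ?case by simp
qed

lemma leibniz_bound_uniform: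
  assumes "j \<le> k" "\<And>i. i \<le> k \<Longrightarrow> \<bar>U i s\<bar> \<le> R" "\<And>i. i \<le> k \<Longrightarrow> \<bar>V i s\<bar> \<le> R"
  shows "\<bar>leibniz j U V s\<bar> \<le> 2 ^ k * R * R"
proof -
  have "\<bar>leibniz j U V s\<bar> \<le> 2 ^ j * R * R"
    using assms by (intro leibniz_bound) auto
  also have "\<dots> \<le> 2 ^ k * R * R"
    \<comment> \<open>Reassociating leaves the common factor \<open>R * R\<close>, nonnegative
      whatever the sign of \<open>R\<close>.\<close>
    unfolding mult.assoc using assms(1) by (intro mult_right_mono power_increasing) auto
  finally show ?thesis .
qed

text \<open>If \<open>\<Phi>\<close>, \<open>V\<close>, \<open>Y\<close> are the sequences of derivatives of \<open>\<phi>\<close>, \<open>v\<close>, \<open>y\<close>, then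
  \<open>chain k \<Phi> V Y\<close> is the \<open>k\<close>-th derivative of \<open>(\<phi> \<circ> y) \<cdot> v\<close>. The factor \<open>v\<close> makes the
  recursion primitive.\<close>

primrec chain :: "nat \<Rightarrow> (nat \<Rightarrow> real \<Rightarrow> real) \<Rightarrow> (nat \<Rightarrow> real \<Rightarrow> real) \<Rightarrow> (nat \<Rightarrow> real \<Rightarrow> real) \<Rightarrow>
    real \<Rightarrow> real" where
  "chain 0 \<Phi> V Y = (\<lambda>s. \<Phi> 0 (Y 0 s) * V 0 s)"
| "chain (Suc k) \<Phi> V Y = (\<lambda>s. chain k \<Phi> (\<lambda>j. V (Suc j)) Y s +
     chain k (\<lambda>j. \<Phi> (Suc j)) (\<lambda>j. leibniz j V (\<lambda>j. Y (Suc j))) Y s)"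

lemma DERIV_compose_deriv_seq:
  assumes "deriv_seq UNIV \<Phi>" "deriv_seq S Y" "s \<in> S"
  shows "((\<lambda>s. \<Phi> k (Y 0 s)) has_real_derivative \<Phi> (Suc k) (Y 0 s) * Y 1 s) (at s within S)"
  using DERIV_chain2[OF deriv_seqD[OF assms(1), of "Y 0 s" k] deriv_seqD[OF assms(2,3), of 0]]
  by simp

text \<open>Differentiating \<open>(\<phi> o y) * v\<close> gives
  \<open>(\<phi> o y) * v' + (\<phi>' o y) * (v * y')\<close>, two products of the same shape;
  \<open>leibniz\<close> supplies the derivatives of the new factor \<open>v * y'\<close>. Hence
  \<open>\<Phi>\<close> and \<open>V\<close> vary in the induction.\<close>

lemma deriv_seq_chain:
  assumes "deriv_seq UNIV \<Phi>" "deriv_seq S V" "deriv_seq S Y"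
  shows "deriv_seq S (\<lambda>k. chain k \<Phi> V Y)"
proof -
  have "(chain k \<Phi> V Y has_real_derivative chain (Suc k) \<Phi> V Y s) (at s within S)"
    if "s \<in> S" for k s
    using assms(1,2)
  proof (induction k arbitrary: \<Phi> V)
    case 0
    show ?case
      using DERIV_mult[OF DERIV_compose_deriv_seq[OF 0(1) assms(3) that, of 0]
          deriv_seqD[OF 0(2) that, of 0]] by (simp add: algebra_simps)
  next
    case (Suc k)
    show ?case
      using DERIV_add[OF Suc.IH[OF Suc.prems(1) deriv_seq_Suc[OF Suc.prems(2)]]
          Suc.IH[OF deriv_seq_Suc[OF Suc.prems(1)]
            deriv_seq_leibniz[OF Suc.prems(2) deriv_seq_Suc[OF assms(3)]]]]
      by simp
  qed
  then show ?thesis by (simp add: deriv_seq_def)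
qed

section \<open>Bounds for derivatives of composites, uniform in the inner function\<close>

lemma deriv_seq_bounded_on_interval:
  assumes "deriv_seq UNIV \<Phi>"
  obtains C where "\<And>t. \<bar>t\<bar> \<le> R \<Longrightarrow> \<bar>\<Phi> k t\<bar> \<le> C"
proof -
  have "continuous_on {-R..R} (\<Phi> k)"
    using deriv_seqD[OF assms] by (metis UNIV_I DERIV_isCont continuous_at_imp_continuous_on)
  then have "bounded (\<Phi> k ` {-R..R})"
    by (intro compact_imp_bounded compact_continuous_image) auto
  then obtain C where "\<forall>t\<in>{-R..R}. \<bar>\<Phi> k t\<bar> \<le> C" unfolding bounded_iff by auto
  then have "\<bar>\<Phi> k t\<bar> \<le> C" if "\<bar>t\<bar> \<le> R" for t using that by (simp add: abs_le_iff)
  then show thesis using that by blast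
qed

text \<open>\<open>R\<close> varies in the induction because the new factor \<open>v * y'\<close>
  obeys only the larger bound \<open>R'\<close>.\<close>

lemma chain_bounded:
  assumes "deriv_seq UNIV \<Phi>"
  shows "\<exists>C. \<forall>V Y s. (\<forall>j\<le>k. \<bar>V j s\<bar> \<le> R \<and> \<bar>Y j s\<bar> \<le> R) \<longrightarrow> \<bar>chain k \<Phi> V Y s\<bar> \<le> C"
  using assms
proof (induction k arbitrary: \<Phi> R)
  case 0
  obtain C where C: "\<And>t. \<bar>t\<bar> \<le> R \<Longrightarrow> \<bar>\<Phi> 0 t\<bar> \<le> C"
    using deriv_seq_bounded_on_interval[OF 0, where k = 0 and R = R] by blast
  have "\<bar>chain 0 \<Phi> V Y s\<bar> \<le> C * R" if "\<forall>j\<le>0. \<bar>V j s\<bar> \<le> R \<and> \<bar>Y j s\<bar> \<le> R" for V Y s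
    using that C[of "Y 0 s"] by (auto simp: abs_mult intro: mult_mono')
  then show ?case by blast
next
  case (Suc k)
  define R' where "R' = max R (2 ^ k * R * R)"
  obtain C1 where C1: "\<And>V Y s. (\<forall>j\<le>k. \<bar>V j s\<bar> \<le> R \<and> \<bar>Y j s\<bar> \<le> R) \<Longrightarrow> \<bar>chain k \<Phi> V Y s\<bar> \<le> C1"
    using Suc.IH[OF Suc.prems, of R] by blast
  obtain C2 where C2: "\<And>V Y s. (\<forall>j\<le>k. \<bar>V j s\<bar> \<le> R' \<and> \<bar>Y j s\<bar> \<le> R') \<Longrightarrow>
      \<bar>chain k (\<lambda>j. \<Phi> (Suc j)) V Y s\<bar> \<le> C2"
    using Suc.IH[OF deriv_seq_Suc[OF Suc.prems], of R'] by blast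
  have "\<bar>chain (Suc k) \<Phi> V Y s\<bar> \<le> C1 + C2"
    if *: "\<forall>j\<le>Suc k. \<bar>V j s\<bar> \<le> R \<and> \<bar>Y j s\<bar> \<le> R" for V Y s
  proof -
    have "\<bar>leibniz j V (\<lambda>j. Y (Suc j)) s\<bar> \<le> R'" if "j \<le> k" for j
      unfolding R'_def using leibniz_bound_uniform[OF that, of V s R "\<lambda>j. Y (Suc j)"] *
      by (simp add: le_max_iff_disj)
    then have "\<bar>chain k (\<lambda>j. \<Phi> (Suc j)) (\<lambda>j. leibniz j V (\<lambda>j. Y (Suc j))) Y s\<bar> \<le> C2"
      using * by (intro C2) (auto simp: R'_def le_max_iff_disj)
    moreover have "\<bar>chain k \<Phi> (\<lambda>j. V (Suc j)) Y s\<bar> \<le> C1"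
      using * by (intro C1) auto
    ultimately show ?thesis by simp
  qed
  then show ?case by blast
qed

text \<open>\<open>V k\<close> arises only when every differentiation falls on \<open>v\<close>.
  Once the composite is differentiated, only derivatives of \<open>v\<close> below order
  \<open>k\<close> and of \<open>y\<close> up to order \<open>k\<close> remain, and
  \<open>chain_bounded\<close> applies.\<close>

lemma chain_top_order:
  assumes "deriv_seq UNIV \<Phi>"
  shows "\<exists>C. \<forall>V Y s. (\<forall>j<k. \<bar>V j s\<bar> \<le> R) \<and> (\<forall>j\<le>k. \<bar>Y j s\<bar> \<le> R) \<longrightarrow>
    \<bar>chain k \<Phi> V Y s - \<Phi> 0 (Y 0 s) * V k s\<bar> \<le> C"
proof (induction k)
  case 0
  then show ?case by auto
next
  case (Suc k)
  define R' where "R' = max R (2 ^ k * R * R)"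
  obtain C1 where C1: "\<And>V Y s. (\<forall>j<k. \<bar>V j s\<bar> \<le> R) \<and> (\<forall>j\<le>k. \<bar>Y j s\<bar> \<le> R) \<Longrightarrow>
      \<bar>chain k \<Phi> V Y s - \<Phi> 0 (Y 0 s) * V k s\<bar> \<le> C1"
    using Suc.IH by blast
  obtain C2 where C2: "\<And>V Y s. (\<forall>j\<le>k. \<bar>V j s\<bar> \<le> R' \<and> \<bar>Y j s\<bar> \<le> R') \<Longrightarrow>
      \<bar>chain k (\<lambda>j. \<Phi> (Suc j)) V Y s\<bar> \<le> C2"
    using chain_bounded[OF deriv_seq_Suc[OF assms], of k R'] by blast
  have "\<bar>chain (Suc k) \<Phi> V Y s - \<Phi> 0 (Y 0 s) * V (Suc k) s\<bar> \<le> C1 + C2"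
    if *: "(\<forall>j<Suc k. \<bar>V j s\<bar> \<le> R) \<and> (\<forall>j\<le>Suc k. \<bar>Y j s\<bar> \<le> R)" for V Y s
  proof -
    have "\<bar>leibniz j V (\<lambda>j. Y (Suc j)) s\<bar> \<le> R'" if "j \<le> k" for j
      unfolding R'_def using leibniz_bound_uniform[OF that, of V s R "\<lambda>j. Y (Suc j)"] *
      by (simp add: le_max_iff_disj)
    then have "\<bar>chain k (\<lambda>j. \<Phi> (Suc j)) (\<lambda>j. leibniz j V (\<lambda>j. Y (Suc j))) Y s\<bar> \<le> C2"
      using * by (intro C2) (auto simp: R'_def le_max_iff_disj)
    moreover have "\<bar>chain k \<Phi> (\<lambda>j. V (Suc j)) Y s - \<Phi> 0 (Y 0 s) * V (Suc k) s\<bar> \<le> C1"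
      using * C1[of "\<lambda>j. V (Suc j)" s Y] by simp
    ultimately show ?thesis by simp
  qed
  then show ?case by blast
qed

section \<open>Smooth functions on the unit interval\<close>

lemma deriv_seq_smooth_deriv: "deriv_seq unit_ivl (\<lambda>k. smooth_deriv k y)"
  by (simp add: deriv_seq_def has_real_derivative_iff_has_vector_derivative smooth_deriv_has_deriv)

lemma smooth_deriv_eq_deriv_seq:
  assumes "deriv_seq unit_ivl F" "\<And>s. s \<in> unit_ivl \<Longrightarrow> eval_smooth y s = F 0 s" "s \<in> unit_ivl"
  shows "smooth_deriv k y s = F k s"
  using assms
  by (intro smooth_deriv_eqI)
    (simp_all add: deriv_seq_def has_real_derivative_iff_has_vector_derivative)

lemma deriv_seq_smooth_fun:
  assumes "deriv_seq unit_ivl F"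
  obtains y :: smooth_fun where "\<And>k s. s \<in> unit_ivl \<Longrightarrow> smooth_deriv k y s = F k s"
proof -
  define y where "y = Abs_smooth_fun (\<lambda>s. if s \<in> unit_ivl then F 0 s else 0)"
  have "smooth_on unit_ivl (\<lambda>s. if s \<in> unit_ivl then F 0 s else 0)"
    using assms
    by (intro smooth_on_unit_ivl_derivI(1)[of F])
      (auto simp: deriv_seq_def has_real_derivative_iff_has_vector_derivative)
  then have "eval_smooth y = (\<lambda>s. if s \<in> unit_ivl then F 0 s else 0)"
    unfolding y_def by (intro Abs_smooth_fun_inverse) auto
  then show thesis
    using smooth_deriv_eq_deriv_seq[OF assms, of y] that[of y] by simp
qed

section \<open>Test functions: constants and oscillations\<close>

lemma smooth_const_exists:
  obtains u :: smooth_fun where "\<And>s. s \<in> unit_ivl \<Longrightarrow> eval_smooth u s = c"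
proof -
  have "deriv_seq unit_ivl (\<lambda>k s. if k = 0 then c else 0)"
    by (simp add: deriv_seq_def)
  then obtain u :: smooth_fun where
    "\<And>k s. s \<in> unit_ivl \<Longrightarrow> smooth_deriv k u s = (if k = 0 then c else 0)"
    using deriv_seq_smooth_fun by blast
  then show thesis using that[of u] by (metis smooth_deriv_0)
qed

lemma smooth_oscillation_exists:
  fixes d s\<^sub>0 :: real
  assumes "d > 0" "s\<^sub>0 \<in> unit_ivl" "n \<ge> 1"
  obtains z :: smooth_fun where "smooth_norm (2 * i) z \<le> d" "eval_smooth z s\<^sub>0 = 0"
    "\<bar>smooth_deriv (2 * i + 1) z s\<^sub>0\<bar> = d * real n"
proof -
  \<comment> \<open>Each differentiation multiplies by \<open>n\<close> and advances the phase by
    \<open>pi / 2\<close>, so one formula serves all orders.\<close>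
  define F :: "nat \<Rightarrow> real \<Rightarrow> real" where "F = (\<lambda>k s.
    d * (real n ^ k / real n ^ (2 * i)) * sin (real n * (s - s\<^sub>0) + real k * (pi / 2)))"
  have "deriv_seq unit_ivl F"
    unfolding deriv_seq_def F_def
  proof (intro allI ballI)
    fix k s
    have "sin (real n * (s - s\<^sub>0) + real (Suc k) * (pi / 2)) =
        cos (real n * (s - s\<^sub>0) + real k * (pi / 2))"
      using sin_add[of "real n * (s - s\<^sub>0) + real k * (pi / 2)" "pi / 2"]
      by (simp add: algebra_simps add_divide_distrib)
    then show "((\<lambda>s. d * (real n ^ k / real n ^ (2 * i)) *
          sin (real n * (s - s\<^sub>0) + real k * (pi / 2))) has_real_derivative
        d * (real n ^ Suc k / real n ^ (2 * i)) *
          sin (real n * (s - s\<^sub>0) + real (Suc k) * (pi / 2))) (at s within unit_ivl)"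
      by (auto intro!: derivative_eq_intros simp only:) (simp add: algebra_simps)
  qed
  then obtain z :: smooth_fun where z: "\<And>k s. s \<in> unit_ivl \<Longrightarrow> smooth_deriv k z s = F k s"
    using deriv_seq_smooth_fun by blast
  have "smooth_norm (2 * i) z \<le> d"
  proof (rule smooth_norm_least)
    fix s l assume s: "s \<in> unit_ivl" and l: "l \<le> 2 * i"
    have "real n ^ l / real n ^ (2 * i) \<le> 1"
      using assms(3) power_increasing[OF l, of "real n"] by simp
    then have "\<bar>d * (real n ^ l / real n ^ (2 * i))\<bar> \<le> d"
      using assms(1) mult_left_mono[of "real n ^ l / real n ^ (2 * i)" 1 d] by (simp add: abs_mult)
    then have "\<bar>F l s\<bar> \<le> d * 1"
      unfolding F_def abs_mult[of _ "sin _"] by (intro mult_mono) (use assms(1) in auto)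
    then show "\<bar>smooth_deriv l z s\<bar> \<le> d" using z[OF s] by simp
  qed
  moreover have "eval_smooth z s\<^sub>0 = 0"
    using z[OF assms(2), of 0] by (simp add: smooth_deriv_0 F_def)
  moreover have "\<bar>smooth_deriv (2 * i + 1) z s\<^sub>0\<bar> = d * real n"
  proof -
    \<comment> \<open>An odd multiple of \<open>pi / 2\<close>; an even order would give the value 0
      at \<open>s\<^sub>0\<close>.\<close>
    have "\<bar>sin (real (2 * i + 1) * (pi / 2))\<bar> = 1"
      using sin_add[of "real i * pi" "pi / 2"] by (simp add: algebra_simps add_divide_distrib)
    then show ?thesis
      using assms z[OF assms(2), of "2 * i + 1"] by (simp add: F_def abs_mult)
  qed
  ultimately show thesis by (rule that)
qed

section \<open>P-norms\<close>

lemma P_norm_zero: "P_norm \<rho> \<Longrightarrow> \<rho> 0 = 0"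
  unfolding P_norm_def using Metric_space.zero[of UNIV "\<lambda>x y. \<rho> (x - y)" 0 0] by simp

text \<open>Used for \<open>\<rho>\<^sub>2\<close>: a small P-norm forces a small norm of any
  prescribed order.\<close>

lemma P_norm_ball_subset:
  assumes "P_norm \<rho>" "open U" "0 \<in> U"
  obtains r where "r > 0" "\<And>w. \<rho> w < r \<Longrightarrow> w \<in> U"
proof -
  interpret Metric_space UNIV "\<lambda>x y. \<rho> (x - y)" using assms(1) by (simp add: P_norm_def)
  have "openin mtopology U" using assms(1,2) by (simp add: P_norm_def)
  then obtain r where r: "r > 0" "mball 0 r \<subseteq> U"
    using assms(3) unfolding openin_mtopology by blast
  have "w \<in> U" if "\<rho> w < r" for w
    using r(2) that commute[of 0 w] by (auto simp: mball_def)
  then show thesis using that r(1) by blast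
qed

lemma open_P_norm_ball:
  assumes "P_norm \<rho>"
  shows "open {w. \<rho> w < r}"
proof -
  interpret Metric_space UNIV "\<lambda>x y. \<rho> (x - y)" using assms by (simp add: P_norm_def)
  have "mball 0 r = {w. \<rho> w < r}" using commute[of 0] by (auto simp: mball_def)
  then show ?thesis using openin_mball[of 0 r] assms by (simp add: P_norm_def)
qed

text \<open>The opposite comparison, used for \<open>\<rho>\<^sub>1\<close>: balls of single norms
  form a base, so one order \<open>i\<close> suffices.\<close>

lemma P_norm_smooth_ball:
  assumes "P_norm \<rho>" "r > 0"
  obtains i e where "e > 0" "\<And>z. smooth_norm i z < e \<Longrightarrow> \<rho> z < r"
proof -
  have "\<forall>x\<in>{w. \<rho> w < r}. \<exists>i. \<exists>e>0. \<forall>y. smooth_norm i (y - x) < e \<longrightarrow> y \<in> {w. \<rho> w < r}"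
    using open_P_norm_ball[OF assms(1), of r] unfolding open_smooth_fun_def .
  then have "\<exists>i. \<exists>e>0. \<forall>y. smooth_norm i (y - 0) < e \<longrightarrow> y \<in> {w. \<rho> w < r}"
    by (rule bspec) (simp add: P_norm_zero[OF assms(1)] assms(2))
  then obtain i e where "e > 0" "\<forall>y. smooth_norm i (y - 0) < e \<longrightarrow> \<rho> y < r"
    by auto
  then show thesis using that[of e i] by simp
qed

text \<open>Scaling the function 1 makes its P-norm small while its value stays nonzero, so
  \<open>\<phi>'\<close> remains visible in the derivative in direction \<open>u\<close>.\<close>

lemma P_norm_small_const:
  fixes \<rho> :: "smooth_fun \<Rightarrow> real"
  assumes "P_norm \<rho>" "r > 0"
  obtains c u where "c > 0" "\<rho> u < r" "\<And>s. s \<in> unit_ivl \<Longrightarrow> eval_smooth u s = c"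
proof -
  obtain v :: smooth_fun where v: "\<And>s. s \<in> unit_ivl \<Longrightarrow> eval_smooth v s = 1"
    using smooth_const_exists by blast
  obtain i e where e: "e > 0" "\<And>z. smooth_norm i z < e \<Longrightarrow> \<rho> z < r"
    using P_norm_smooth_ball[OF assms] by blast
  \<comment> \<open>The summand 1 keeps the denominator positive and makes the resulting norm
    strictly less than \<open>e\<close>.\<close>
  define c where "c = e / (1 + smooth_norm i v)"
  have pos: "0 < 1 + smooth_norm i v" using smooth_norm_nonneg[of i v] by simp
  then have c: "c > 0" using e(1) by (simp add: c_def)
  have "smooth_norm i (c *\<^sub>R v) \<le> c * smooth_norm i v"
    using smooth_norm_scaleR_le[of i c v] c by simp
  also have "\<dots> < e" using pos e(1) by (simp add: c_def field_simps)
  finally have "\<rho> (c *\<^sub>R v) < r" by (rule e(2))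
  then show thesis using that[OF c] v by (simp add: scaleR_smooth_fun.rep_eq)
qed

section \<open>Superposition operators\<close>

lemma smooth_on_UNIV_deriv_seq:
  assumes "smooth_on UNIV \<phi>"
  obtains \<Phi> where "deriv_seq UNIV \<Phi>" "\<Phi> 0 = \<phi>"
proof
  show "deriv_seq UNIV (\<lambda>k. (deriv_within UNIV ^^ k) \<phi>)"
    using assms
    by (simp add: deriv_seq_def has_real_derivative_iff_has_vector_derivative deriv_within_def
        smooth_on_def differentiable_on_def vector_derivative_works)
qed simp

text \<open>The limit exists in the space by hypothesis; convergence there is pointwise, and the
  classical chain rule identifies the values.\<close>

lemma eval_smooth_dir_deriv:
  fixes f :: "smooth_fun \<Rightarrow> smooth_fun"
  assumes f: "\<And>y s. s \<in> unit_ivl \<Longrightarrow> eval_smooth (f y) s = \<phi> (eval_smooth y s)"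
    and \<phi>: "\<And>t. (\<phi> has_real_derivative \<phi>' t) (at t)"
    and "dir_differentiable_on UNIV f" and s: "s \<in> unit_ivl"
  shows "eval_smooth (dir_deriv f y u) s = \<phi>' (eval_smooth y s) * eval_smooth u s"
proof -
  let ?l = "dir_deriv f y u" and ?y = "eval_smooth y s" and ?u = "eval_smooth u s"
  obtain l where "(dir_quotient f y u \<longlongrightarrow> l) (at 0)"
    using assms(3) unfolding dir_differentiable_on_def by blast
  then have "(dir_quotient f y u \<longlongrightarrow> ?l) (at 0)"
    by (simp add: dir_deriv_def tendsto_Lim)
  then have *: "((\<lambda>t. smooth_norm 0 (dir_quotient f y u t - ?l)) \<longlongrightarrow> 0) (at 0)"
    using tendsto_smooth_fun_iff by blast
  \<comment> \<open>Evaluation at \<open>s\<close> is 1-Lipschitz for the norm of order 0.\<close>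
  have "\<bar>eval_smooth v s - eval_smooth w s\<bar> \<le> smooth_norm 0 (v - w)" for v w
    using smooth_norm_upper[OF s order_refl, of 0 "v - w"] smooth_deriv_diff[OF s, of 0 v w]
    by (simp add: smooth_deriv_0)
  then have "((\<lambda>t. eval_smooth (dir_quotient f y u t) s - eval_smooth ?l s) \<longlongrightarrow> 0) (at 0)"
    by (intro tendsto_0_le[OF *, of _ 1] always_eventually) (simp add: smooth_norm_nonneg)
  then have "((\<lambda>t. eval_smooth (dir_quotient f y u t) s) \<longlongrightarrow> eval_smooth ?l s) (at 0)"
    by (rule Lim_null[THEN iffD2])
  moreover have "eval_smooth (dir_quotient f y u t) s = (\<phi> (?y + t * ?u) - \<phi> ?y) / t" for t
    using smooth_deriv_diff[OF s, of 0 "f (y + t *\<^sub>R u)" "f y"]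
    by (simp add: dir_quotient_def scaleR_smooth_fun.rep_eq plus_smooth_fun.rep_eq
        f[OF s] smooth_deriv_0)
  moreover have "((\<lambda>t. (\<phi> (?y + t * ?u) - \<phi> ?y) / t) \<longlongrightarrow> \<phi>' ?y * ?u) (at 0)"
  proof -
    have "((\<lambda>t. \<phi> (?y + t * ?u)) has_real_derivative \<phi>' ?y * ?u) (at 0)"
      by (rule DERIV_chain2[of \<phi>]) (use \<phi>[of ?y] in \<open>auto intro!: derivative_eq_intros\<close>)
    then show ?thesis by (simp add: DERIV_def)
  qed
  ultimately show ?thesis
    using tendsto_unique[OF trivial_limit_at] by auto
qed

text \<open>After one differentiation the composite is \<open>(\<Phi> 1 o y) * y'\<close>, so
  \<open>chain_top_order\<close> applies with \<open>V\<close> the shifted derivatives of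
  \<open>y\<close>; its term \<open>V k\<close> is then the derivative of \<open>y\<close> of order
  \<open>Suc k\<close>.\<close>

lemma smooth_deriv_compose_top_order:
  assumes "deriv_seq UNIV \<Phi>"
  obtains C where "\<And>h y s. s \<in> unit_ivl \<Longrightarrow> smooth_norm k y \<le> R \<Longrightarrow>
      (\<And>s. s \<in> unit_ivl \<Longrightarrow> eval_smooth h s = \<Phi> 0 (eval_smooth y s)) \<Longrightarrow>
      \<bar>smooth_deriv (Suc k) h s - \<Phi> 1 (eval_smooth y s) * smooth_deriv (Suc k) y s\<bar> \<le> C"
proof -
  let ?\<Phi> = "\<lambda>j. \<Phi> (Suc j)"
  obtain C where C: "\<And>V Y s. (\<forall>j<k. \<bar>V j s\<bar> \<le> R) \<and> (\<forall>j\<le>k. \<bar>Y j s\<bar> \<le> R) \<Longrightarrow>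
      \<bar>chain k ?\<Phi> V Y s - ?\<Phi> 0 (Y 0 s) * V k s\<bar> \<le> C"
    using chain_top_order[OF deriv_seq_Suc[OF assms], of k R] by blast
  have "\<bar>smooth_deriv (Suc k) h s - \<Phi> 1 (eval_smooth y s) * smooth_deriv (Suc k) y s\<bar> \<le> C"
    if s: "s \<in> unit_ivl" and R: "smooth_norm k y \<le> R"
      and h: "\<And>s. s \<in> unit_ivl \<Longrightarrow> eval_smooth h s = \<Phi> 0 (eval_smooth y s)" for h y s
  proof -
    let ?Y = "\<lambda>j. smooth_deriv j y"
    let ?V = "\<lambda>j. ?Y (Suc j)"
    let ?F = "\<lambda>j. case j of 0 \<Rightarrow> (\<lambda>s. \<Phi> 0 (?Y 0 s)) | Suc k \<Rightarrow> chain k ?\<Phi> ?V ?Y"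
    note Y = deriv_seq_smooth_deriv[of y]
    have "deriv_seq unit_ivl ?F"
      using DERIV_compose_deriv_seq[OF assms Y, of _ 0]
        deriv_seqD[OF deriv_seq_chain[OF deriv_seq_Suc[OF assms] deriv_seq_Suc[OF Y] Y]]
      by (auto simp: deriv_seq_def split: nat.split)
    then have "smooth_deriv (Suc k) h s = chain k ?\<Phi> ?V ?Y s"
      using smooth_deriv_eq_deriv_seq[of ?F h s "Suc k"] h s by (simp add: smooth_deriv_0)
    moreover have "\<bar>?Y j s\<bar> \<le> R" if "j \<le> k" for j
      using smooth_norm_upper[OF s that, of y] R by linarith
    ultimately show ?thesis using C[of ?V s ?Y] by (simp add: smooth_deriv_0)
  qed
  then show thesis by (rule that)
qed

section \<open>Oscillating perturbations against the tame estimate\<close>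

theorem proposition5:
  fixes \<phi> :: "real \<Rightarrow> real" and f :: "smooth_fun \<Rightarrow> smooth_fun" and x :: smooth_fun
  assumes "smooth_diffeomorphism \<phi>"
    and "\<And>y s. s \<in> {0..1} \<Longrightarrow> eval_smooth (f y) s = \<phi> (eval_smooth y s)"
    and "almost_M_tame UNIV f x"
  shows "\<forall>t \<in> eval_smooth x ` {0..1}. deriv (deriv \<phi>) t = 0"
proof
  fix t assume "t \<in> eval_smooth x ` {0..1}"
  then obtain s\<^sub>0 where s\<^sub>0: "s\<^sub>0 \<in> unit_ivl" and t: "t = eval_smooth x s\<^sub>0" by blast
  obtain \<Phi> where \<Phi>: "deriv_seq UNIV \<Phi>" "\<Phi> 0 = \<phi>"
    using assms(1) smooth_on_UNIV_deriv_seq unfolding smooth_diffeomorphism_def by blast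
  have deriv_\<Phi>: "deriv (\<Phi> k) = \<Phi> (Suc k)" for k
    using deriv_seqD[OF \<Phi>(1)] by (auto intro!: ext DERIV_imp_deriv)
  have deriv2: "deriv (deriv \<phi>) = \<Phi> 2"
    by (simp add: \<Phi>(2)[symmetric] deriv_\<Phi> numeral_2_eq_2)
  have diff: "dir_differentiable_on UNIV f"
    using assms(3) by (simp add: almost_M_tame_def)
  obtain \<rho>\<^sub>1 \<rho>\<^sub>2 :: "smooth_fun \<Rightarrow> real" where P: "P_norm \<rho>\<^sub>1" "P_norm \<rho>\<^sub>2"
    and tame: "\<And>z u. \<rho>\<^sub>1 z \<le> 1 \<Longrightarrow> \<rho>\<^sub>2 (dir_deriv f (x + z) u - dir_deriv f x u) \<le> \<rho>\<^sub>1 u"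
    using assms(3) unfolding almost_M_tame_def by blast
  obtain i e where e: "e > 0" "\<And>z. smooth_norm i z < e \<Longrightarrow> \<rho>\<^sub>1 z < 1"
    using P_norm_smooth_ball[OF P(1) zero_less_one] by blast
  \<comment> \<open>Order of choices: \<open>\<rho>\<^sub>1\<close> fixes \<open>i\<close>, then
    \<open>\<rho>\<^sub>2\<close> gives \<open>r\<close> for the higher order
    \<open>2 * i + 1\<close>, and only then is \<open>u\<close> chosen.\<close>
  obtain r where r: "r > 0" "\<And>w. \<rho>\<^sub>2 w < r \<Longrightarrow> smooth_norm (2 * i + 1) w < 1"
    using P_norm_ball_subset[OF P(2) open_smooth_ball[of "2 * i + 1" 0 1]] by auto
  obtain c u where c: "c > 0" and u: "\<rho>\<^sub>1 u < r" "\<And>s. s \<in> unit_ivl \<Longrightarrow> eval_smooth u s = c"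
    using P_norm_small_const[OF P(1) r(1)] by blast
  let ?H = "\<lambda>z. dir_deriv f (x + z) u"
  have H: "eval_smooth (?H z) s = c * \<Phi> 1 (eval_smooth (x + z) s)" if "s \<in> unit_ivl" for z s
    using eval_smooth_dir_deriv[of f \<phi> "\<Phi> 1" s "x + z" u, OF assms(2) _ diff that]
      deriv_seqD[OF \<Phi>(1), of _ 0] \<Phi>(2) u(2)[OF that] by simp
  \<comment> \<open>The oscillation attains its bound only non-strictly, whereas the ball of radius
    \<open>e\<close> is strict.\<close>
  define d where "d = e / 2"
  have d: "0 < d" "d < e" using e(1) by (auto simp: d_def)
  \<comment> \<open>Absorbing \<open>c\<close> into the outer function makes \<open>?H z\<close> a
    composite with \<open>x + z\<close>.\<close>
  have \<Psi>: "deriv_seq UNIV (\<lambda>k t. c * \<Phi> (Suc k) t)"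
    using deriv_seqD[OF \<Phi>(1)] by (auto simp: deriv_seq_def intro!: DERIV_cmult)
  obtain C where C: "\<And>h y s. s \<in> unit_ivl \<Longrightarrow> smooth_norm (2 * i) y \<le> smooth_norm (2 * i) x + d \<Longrightarrow>
      (\<And>s. s \<in> unit_ivl \<Longrightarrow> eval_smooth h s = c * \<Phi> 1 (eval_smooth y s)) \<Longrightarrow>
      \<bar>smooth_deriv (2 * i + 1) h s - c * \<Phi> 2 (eval_smooth y s) * smooth_deriv (2 * i + 1) y s\<bar> \<le> C"
    using smooth_deriv_compose_top_order[OF \<Psi>, of "2 * i" "smooth_norm (2 * i) x + d"]
    by (auto simp: numeral_2_eq_2)
  let ?x = "smooth_deriv (2 * i + 1) x s\<^sub>0" and ?h = "smooth_deriv (2 * i + 1) (?H 0) s\<^sub>0"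
  \<comment> \<open>All contributions independent of \<open>n\<close>: \<open>C\<close> from the
    lower-order terms, 1 from tameness, the rest from the base point \<open>x\<close>.\<close>
  define M where "M = C + 1 + \<bar>?h\<bar> + \<bar>c * \<Phi> 2 t * ?x\<bar>"
  have bound: "c * \<bar>\<Phi> 2 t\<bar> * d * real n \<le> M" if n: "n \<ge> 1" for n
  proof -
    obtain z where z: "smooth_norm (2 * i) z \<le> d" "eval_smooth z s\<^sub>0 = 0"
      "\<bar>smooth_deriv (2 * i + 1) z s\<^sub>0\<bar> = d * real n"
      using smooth_oscillation_exists[OF d(1) s\<^sub>0 n] by blast
    have "smooth_norm i z < e" using smooth_norm_mono[of i "2 * i" z] z(1) d(2) by simp
    then have "\<rho>\<^sub>1 z \<le> 1" using e(2) by fastforce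
    then have "smooth_norm (2 * i + 1) (?H z - ?H 0) < 1"
      using tame[of z u] u(1) by (intro r(2)) simp
    then have "\<bar>smooth_deriv (2 * i + 1) (?H z) s\<^sub>0 - ?h\<bar> \<le> 1"
      using smooth_norm_upper[OF s\<^sub>0 order_refl, of "2 * i + 1" "?H z - ?H 0"]
      by (simp only: smooth_deriv_diff[OF s\<^sub>0])
    moreover have "smooth_norm (2 * i) (x + z) \<le> smooth_norm (2 * i) x + d"
      using smooth_norm_triangle[of "2 * i" x z] z(1) by simp
    from C[OF s\<^sub>0 this H]
    have "\<bar>smooth_deriv (2 * i + 1) (?H z) s\<^sub>0 -
        c * \<Phi> 2 t * (?x + smooth_deriv (2 * i + 1) z s\<^sub>0)\<bar> \<le> C"
      by (simp add: smooth_deriv_add[OF s\<^sub>0] plus_smooth_fun.rep_eq z(2) t)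
    ultimately have "\<bar>c * \<Phi> 2 t * smooth_deriv (2 * i + 1) z s\<^sub>0\<bar> \<le> M"
      unfolding M_def by (simp add: distrib_left)
    then show ?thesis using c z(3) by (simp add: abs_mult mult.assoc)
  qed
  have "\<Phi> 2 t = 0"
  proof (rule ccontr)
    assume "\<Phi> 2 t \<noteq> 0"
    then have pos: "0 < c * \<bar>\<Phi> 2 t\<bar> * d" using c d(1) by simp
    then obtain n where n: "M < real n * (c * \<bar>\<Phi> 2 t\<bar> * d)"
      using reals_Archimedean3 by blast
    \<comment> \<open>\<open>n\<close> may be 0, while \<open>bound\<close> requires an index of at
      least 1.\<close>
    also have "\<dots> \<le> real (Suc n) * (c * \<bar>\<Phi> 2 t\<bar> * d)"
      using pos by (intro mult_right_mono) auto
    finally show False using bound[of "Suc n"] by (simp only: mult.commute) linarith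
  qed
  then show "deriv (deriv \<phi>) t = 0" by (simp add: deriv2)
qed

end
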